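(* Let $\Sigma$ be a finite alphabet containing a letter $a$. Cancellation fails in $\widetilde{\Sigma}^*$: with $U=[(a^{\lfloor\varepsilon^{-1}\rfloor})_\varepsilon]$ and $P=[(a^{\lfloor\log_2(1/\varepsilon)\rfloor})_\varepsilon]$, one has $U P=U=U\mathbf{1}$ while $P\neq\mathbf{1}$. In particular $\widetilde{\Sigma}^*$ is not left cancellative.
   Context: A monoid is left cancellative if $xy=xz$ implies $y=z$. $\Sigma^*$ is the free monoid of finite words over $\Sigma$ under concatenation, $\lambda$ is the empty word, $|w|$ is the length of $w$. For $u\neq v$ in $\Sigma^*$, $\operatorname{lcp}(u,v)$ and $\operatorname{lcs}(u,v)$ are the lengths of the longest common prefix and of the longest common suffix of $u,v$; by convention $\operatorname{lcp}(u,u)=\operatorname{lcs}(u,u)=+\infty$. A net of words is a family $(w_\varepsilon)_{\varepsilon\in(0,1]}$ of words in $\Sigma^*$. It is moderate if there exist $N\in\mathbb{N}$, $C>0$, $\varepsilon_0>0$ with $|w_\varepsilon|\le C\varepsilon^{-N}$ for all $\varepsilon<\varepsilon_0$. $\mathcal{E}_M(\Sigma^* )$ is the set of moderate nets. Two moderate nets are equivalent, $(u_\varepsilon)\sim(v_\varepsilon)$, if for every $m\in\mathbb{N}$ there exists $\varepsilon_0>0$ such that $\min\{\operatorname{lcp}(u_\varepsilon,v_\varepsilon),\operatorname{lcs}(u_\varepsilon,v_\varepsilon)\}\ge m\log_2(1/\varepsilon)$ for all $\varepsilon<\varepsilon_0$; this is an equivalence relation. $\widetilde{\Sigma}^*:=\mathcal{E}_M(\Sigma^*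 )/\sim$ is a monoid under the well-defined product $[(u_\varepsilon)]\cdot[(v_\varepsilon)]:=[(u_\varepsilon v_\varepsilon)]$, with identity $\mathbf{1}=[(\lambda)_\varepsilon]$. *)

theory Defs
  imports Complex_Main "HOL-Library.Extended_Real" "HOL-Library.Sublist"
    "HOL-Library.FuncSet" "HOL-Algebra.Group"
begin

definition left_cancellative :: "('a, 'b) monoid_scheme \<Rightarrow> bool" where
  "left_cancellative M \<longleftrightarrow>
     (\<forall>x\<in>carrier M. \<forall>y\<in>carrier M. \<forall>z\<in>carrier M.
        x \<otimes>\<^bsub>M\<^esub> y = x \<otimes>\<^bsub>M\<^esub> z \<longrightarrow> y = z)"

definition lcp :: "'a list \<Rightarrow> 'a list \<Rightarrow> enat" where
  "lcp u v = (if u = v then \<infinity> else enat (length (longest_common_prefix u v)))"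

definition lcs :: "'a list \<Rightarrow> 'a list \<Rightarrow> enat" where
  "lcs u v = (if u = v then \<infinity> else enat (length (longest_common_prefix (rev u) (rev v))))"

text \<open>Nets are functions on the half-open interval from 0 to 1; as elements of an extensional
  function space they carry no information outside of it.\<close>

definition nets :: "'a set \<Rightarrow> (real \<Rightarrow> 'a list) set" where
  "nets \<Sigma> = {0<..1} \<rightarrow>\<^sub>E lists \<Sigma>"

definition moderate :: "(real \<Rightarrow> 'a list) \<Rightarrow> bool" where
  "moderate w \<longleftrightarrow>
     (\<exists>N::nat. \<exists>C::real. \<exists>\<epsilon>\<^sub>0::real. C > 0 \<and> \<epsilon>\<^sub>0 > 0 \<and>
        (\<forall>\<epsilon>\<in>{0<..1}. \<epsilon> < \<epsilon>\<^sub>0 \<longrightarrow> real (length (w \<epsilon>)) \<le> C * \<epsilon> powi (- int N)))"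

definition moderate_nets :: "'a set \<Rightarrow> (real \<Rightarrow> 'a list) set" where
  "moderate_nets \<Sigma> = {w \<in> nets \<Sigma>. moderate w}"

definition net_equiv :: "'a set \<Rightarrow> ((real \<Rightarrow> 'a list) \<times> (real \<Rightarrow> 'a list)) set" where
  "net_equiv \<Sigma> =
     {(u, v). u \<in> moderate_nets \<Sigma> \<and> v \<in> moderate_nets \<Sigma> \<and>
        (\<forall>m::nat. \<exists>\<epsilon>\<^sub>0::real. \<epsilon>\<^sub>0 > 0 \<and> (\<forall>\<epsilon>\<in>{0<..1}. \<epsilon> < \<epsilon>\<^sub>0 \<longrightarrow>
           ereal_of_enat (min (lcp (u \<epsilon>) (v \<epsilon>)) (lcs (u \<epsilon>) (v \<epsilon>)))
             \<ge> ereal (real m * log 2 (1 / \<epsilon>))))}"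

definition net_class :: "'a set \<Rightarrow> (real \<Rightarrow> 'a list) \<Rightarrow> (real \<Rightarrow> 'a list) set" where
  "net_class \<Sigma> w = net_equiv \<Sigma> `` {restrict w {0<..1}}"

text \<open>The union over all pairs of representatives is the product class, because it does not
  depend on the representatives (lemma \<open>generalized_words_mult\<close> below).\<close>

definition generalized_words :: "'a set \<Rightarrow> (real \<Rightarrow> 'a list) set monoid" where
  "generalized_words \<Sigma> =
     \<lparr>carrier = moderate_nets \<Sigma> // net_equiv \<Sigma>,
      mult = (\<lambda>A B. \<Union>u\<in>A. \<Union>v\<in>B. net_class \<Sigma> (\<lambda>\<epsilon>. u \<epsilon> @ v \<epsilon>)),
      one = net_class \<Sigma> (\<lambda>\<epsilon>. [])\<rparr>"


subsection \<open>Well-definedness\<close>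

lemma lcs_eq_lcp_rev: "lcs u v = lcp (rev u) (rev v)"
  by (simp add: lcs_def lcp_def)

lemma enat_le_lcp_iff:
  "enat k \<le> lcp u v \<longleftrightarrow> u = v \<or> k \<le> length u \<and> k \<le> length v \<and> take k u = take k v"
proof (cases "u = v")
  case False
  have "k \<le> length (longest_common_prefix u v) \<longleftrightarrow>
          k \<le> length u \<and> k \<le> length v \<and> take k u = take k v" for k
  proof (induction u v arbitrary: k rule: longest_common_prefix.induct)
    case (1 x xs y ys)
    then show ?case by (cases k) auto
  qed auto
  with False show ?thesis by (simp add: lcp_def)
qed (simp add: lcp_def)

lemma enat_le_by_nat:
  fixes x y :: enat
  assumes "\<And>k. enat k \<le> x \<Longrightarrow> enat k \<le> y"
  shows "x \<le> y"
proof (cases x)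
  case (enat n)
  with assms[of n] show ?thesis by simp
next
  case infinity
  with assms have "enat k \<le> y" for k by simp
  then have "y = \<infinity>" by (metis enat_ord_simps(1) not_enat_eq Suc_n_not_le_n)
  then show ?thesis by simp
qed

lemma lcp_trans: "min (lcp u v) (lcp v w) \<le> lcp u w"
  by (rule enat_le_by_nat) (auto simp: enat_le_lcp_iff)

lemma lcp_append: "min (lcp u u') (lcp v v') \<le> lcp (u @ v) (u' @ v')"
proof (rule enat_le_by_nat)
  fix k assume "enat k \<le> min (lcp u u') (lcp v v')"
  then have u: "u = u' \<or> k \<le> length u \<and> k \<le> length u' \<and> take k u = take k u'"
    and v: "v = v' \<or> k \<le> length v \<and> k \<le> length v' \<and> take k v = take k v'"
    by (simp_all add: enat_le_lcp_iff)
  have "take (k - length u) v = take (k - length u) v'"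
  proof (cases "v = v'")
    case False
    with v have "take (k - length u) (take k v) = take (k - length u) (take k v')" by simp
    then show ?thesis by (simp add: min_def)
  qed simp
  then have "take k (u @ v) = take k (u' @ v')"
    using u by (cases "u = u'") simp_all
  moreover have "u @ v = u' @ v' \<or> k \<le> length (u @ v) \<and> k \<le> length (u' @ v')"
    using u v by (cases "u = u'"; cases "v = v'") simp_all
  ultimately show "enat k \<le> lcp (u @ v) (u' @ v')"
    unfolding enat_le_lcp_iff by simp
qed

definition agreement :: "'a list \<Rightarrow> 'a list \<Rightarrow> enat" where
  "agreement u v = min (lcp u v) (lcs u v)"

lemma agreement_refl: "agreement u u = \<infinity>"
  by (simp add: agreement_def lcp_def lcs_def)

lemma agreement_sym: "agreement u v = agreement v u"
proof -
  have "lcp u v = lcp v u" for u v :: "'a list"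
    by (rule antisym; rule enat_le_by_nat) (auto simp: enat_le_lcp_iff)
  then show ?thesis by (simp add: agreement_def lcs_eq_lcp_rev)
qed

lemma agreement_trans: "min (agreement u v) (agreement v w) \<le> agreement u w"
  using lcp_trans[of u v w] lcp_trans[of "rev u" "rev v" "rev w"]
  by (auto simp: agreement_def lcs_eq_lcp_rev min_le_iff_disj)

lemma agreement_append: "min (agreement u u') (agreement v v') \<le> agreement (u @ v) (u' @ v')"
  using lcp_append[of u u' v v'] lcp_append[of "rev v" "rev v'" "rev u" "rev u'"]
  by (auto simp: agreement_def lcs_eq_lcp_rev min_le_iff_disj)

lemma net_equiv_iff:
  "(u, v) \<in> net_equiv \<Sigma> \<longleftrightarrow> u \<in> moderate_nets \<Sigma> \<and> v \<in> moderate_nets \<Sigma> \<and>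
     (\<forall>m::nat. \<exists>\<epsilon>\<^sub>0>0. \<forall>\<epsilon>\<in>{0<..1}. \<epsilon> < \<epsilon>\<^sub>0 \<longrightarrow>
        ereal (real m * log 2 (1 / \<epsilon>)) \<le> ereal_of_enat (agreement (u \<epsilon>) (v \<epsilon>)))"
  unfolding net_equiv_def agreement_def by auto

lemma le_agreement_combine:
  assumes "\<exists>\<epsilon>\<^sub>1>0. \<forall>\<epsilon>\<in>{0<..1}. \<epsilon> < \<epsilon>\<^sub>1 \<longrightarrow> b \<epsilon> \<le> ereal_of_enat (f \<epsilon>)"
    and "\<exists>\<epsilon>\<^sub>2>0. \<forall>\<epsilon>\<in>{0<..1}. \<epsilon> < \<epsilon>\<^sub>2 \<longrightarrow> b \<epsilon> \<le> ereal_of_enat (g \<epsilon>)"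
    and h: "\<And>\<epsilon>. \<epsilon> \<in> {0<..1} \<Longrightarrow> min (f \<epsilon>) (g \<epsilon>) \<le> h \<epsilon>"
  shows "\<exists>\<epsilon>\<^sub>0>0::real. \<forall>\<epsilon>\<in>{0<..1}. \<epsilon> < \<epsilon>\<^sub>0 \<longrightarrow> b \<epsilon> \<le> ereal_of_enat (h \<epsilon>)"
proof -
  obtain e1 e2 :: real where e: "e1 > 0" "e2 > 0"
    "\<And>\<epsilon>. \<epsilon> \<in> {0<..1} \<Longrightarrow> \<epsilon> < e1 \<Longrightarrow> b \<epsilon> \<le> ereal_of_enat (f \<epsilon>)"
    "\<And>\<epsilon>. \<epsilon> \<in> {0<..1} \<Longrightarrow> \<epsilon> < e2 \<Longrightarrow> b \<epsilon> \<le> ereal_of_enat (g \<epsilon>)"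
    using assms(1,2) by blast
  have "b \<epsilon> \<le> ereal_of_enat (h \<epsilon>)" if "\<epsilon> \<in> {0<..1}" "\<epsilon> < min e1 e2" for \<epsilon>
  proof -
    have "b \<epsilon> \<le> ereal_of_enat (min (f \<epsilon>) (g \<epsilon>))"
      using e(3,4)[OF that(1)] that(2)
      by (cases "f \<epsilon> \<le> g \<epsilon>") (simp_all add: min_def del: ereal_of_enat_le_iff split: if_splits)
    also have "\<dots> \<le> ereal_of_enat (h \<epsilon>)" using h[OF that(1)] by simp
    finally show ?thesis .
  qed
  then show ?thesis using e(1,2) by (intro exI[of _ "min e1 e2"]) auto
qed

lemma equiv_net_equiv: "equiv (moderate_nets \<Sigma>) (net_equiv \<Sigma>)"
proof (rule equivI)
  show "net_equiv \<Sigma> \<subseteq> moderate_nets \<Sigma> \<times> moderate_nets \<Sigma>"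
    by (auto simp: net_equiv_iff)
  show "refl_on (moderate_nets \<Sigma>) (net_equiv \<Sigma>)"
    by (auto simp: refl_on_def net_equiv_iff agreement_refl intro: exI[of _ 1])
  show "sym (net_equiv \<Sigma>)"
    by (auto simp: sym_def net_equiv_iff agreement_sym)
  show "trans (net_equiv \<Sigma>)"
  proof (rule transI)
    fix u v w assume uv: "(u, v) \<in> net_equiv \<Sigma>" and vw: "(v, w) \<in> net_equiv \<Sigma>"
    have "\<exists>\<epsilon>\<^sub>0>0. \<forall>\<epsilon>\<in>{0<..1}. \<epsilon> < \<epsilon>\<^sub>0 \<longrightarrow>
        ereal (real m * log 2 (1 / \<epsilon>)) \<le> ereal_of_enat (agreement (u \<epsilon>) (w \<epsilon>))" for m :: nat
      by (rule le_agreement_combine[of _ "\<lambda>\<epsilon>. agreement (u \<epsilon>) (v \<epsilon>)" "\<lambda>\<epsilon>. agreement (v \<epsilon>) (w \<epsilon>)"])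
         (use uv vw in \<open>auto simp: net_equiv_iff intro: agreement_trans\<close>)
    with uv vw show "(u, w) \<in> net_equiv \<Sigma>" by (auto simp: net_equiv_iff)
  qed
qed

lemma moderate_nets_append:
  assumes "u \<in> moderate_nets \<Sigma>" "v \<in> moderate_nets \<Sigma>"
  shows "(\<lambda>\<epsilon>\<in>{0<..1}. u \<epsilon> @ v \<epsilon>) \<in> moderate_nets \<Sigma>"
proof -
  obtain N C e where u: "C > 0" "e > 0"
    "\<And>\<epsilon>. \<epsilon> \<in> {0<..1} \<Longrightarrow> \<epsilon> < e \<Longrightarrow> real (length (u \<epsilon>)) \<le> C * \<epsilon> powi (- int N)"
    using assms(1) unfolding moderate_nets_def moderate_def by blast
  obtain N' C' e' where v: "C' > 0" "e' > 0"
    "\<And>\<epsilon>. \<epsilon> \<in> {0<..1} \<Longrightarrow> \<epsilon> < e' \<Longrightarrow> real (length (v \<epsilon>)) \<le> C' * \<epsilon> powi (- int N')"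
    using assms(2) unfolding moderate_nets_def moderate_def by blast
  have mono: "\<epsilon> powi (- int K) \<le> \<epsilon> powi (- int (N + N'))"
    if "\<epsilon> \<in> {0<..1}" "K \<le> N + N'" for \<epsilon> :: real and K
  proof -
    have "\<epsilon> ^ (N + N') \<le> \<epsilon> ^ K" using that by (intro power_decreasing) auto
    moreover have "\<epsilon> ^ (N + N') > 0" using that by simp
    ultimately have "inverse (\<epsilon> ^ K) \<le> inverse (\<epsilon> ^ (N + N'))" by (rule le_imp_inverse_le)
    then show ?thesis by (simp add: power_int_minus del: of_nat_add)
  qed
  have "real (length (u \<epsilon> @ v \<epsilon>)) \<le> (C + C') * \<epsilon> powi (- int (N + N'))"
    if \<epsilon>: "\<epsilon> \<in> {0<..1}" "\<epsilon> < min e e'" for \<epsilon>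
  proof -
    have "C * \<epsilon> powi (- int N) \<le> C * \<epsilon> powi (- int (N + N'))"
         "C' * \<epsilon> powi (- int N') \<le> C' * \<epsilon> powi (- int (N + N'))"
      using mono[OF \<epsilon>(1)] u(1) v(1) by (auto intro!: mult_left_mono simp del: of_nat_add)
    with u(3)[of \<epsilon>] v(3)[of \<epsilon>] \<epsilon> show ?thesis
      by (simp add: distrib_right del: of_nat_add)
  qed
  then have "moderate (\<lambda>\<epsilon>\<in>{0<..1}. u \<epsilon> @ v \<epsilon>)"
    unfolding moderate_def using u(1,2) v(1,2)
    by (intro exI[of _ "N + N'"] exI[of _ "C + C'"] exI[of _ "min e e'"]) auto
  moreover have "(\<lambda>\<epsilon>\<in>{0<..1}. u \<epsilon> @ v \<epsilon>) \<in> nets \<Sigma>"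
    using assms by (auto simp: moderate_nets_def nets_def PiE_def Pi_def)
  ultimately show ?thesis by (simp add: moderate_nets_def)
qed

lemma moderate_nets_Nil: "(\<lambda>\<epsilon>\<in>{0<..1}. []) \<in> moderate_nets \<Sigma>"
  by (auto simp: moderate_nets_def nets_def moderate_def intro!: exI[of _ 0] exI[of _ 1])

lemma net_equiv_append:
  assumes uu': "(u, u') \<in> net_equiv \<Sigma>" and vv': "(v, v') \<in> net_equiv \<Sigma>"
  shows "(\<lambda>\<epsilon>\<in>{0<..1}. u \<epsilon> @ v \<epsilon>, \<lambda>\<epsilon>\<in>{0<..1}. u' \<epsilon> @ v' \<epsilon>) \<in> net_equiv \<Sigma>"
proof -
  let ?f = "\<lambda>\<epsilon>\<in>{0<..1}. u \<epsilon> @ v \<epsilon>" and ?g = "\<lambda>\<epsilon>\<in>{0<..1}. u' \<epsilon> @ v' \<epsilon>"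
  have "\<exists>\<epsilon>\<^sub>0>0. \<forall>\<epsilon>\<in>{0<..1}. \<epsilon> < \<epsilon>\<^sub>0 \<longrightarrow>
      ereal (real m * log 2 (1 / \<epsilon>)) \<le> ereal_of_enat (agreement (?f \<epsilon>) (?g \<epsilon>))" for m :: nat
    by (rule le_agreement_combine[of _ "\<lambda>\<epsilon>. agreement (u \<epsilon>) (u' \<epsilon>)" "\<lambda>\<epsilon>. agreement (v \<epsilon>) (v' \<epsilon>)"])
       (use uu' vv' in \<open>auto simp: net_equiv_iff intro: agreement_append\<close>)
  moreover have "?f \<in> moderate_nets \<Sigma>" "?g \<in> moderate_nets \<Sigma>"
    using uu' vv' by (auto simp: net_equiv_iff intro!: moderate_nets_append)
  ultimately show ?thesis by (simp only: net_equiv_iff) blast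
qed

lemma restrict_moderate_net:
  "u \<in> moderate_nets \<Sigma> \<Longrightarrow> restrict u {0<..1} = u"
  by (auto simp: moderate_nets_def nets_def PiE_restrict)

lemma generalized_words_carrierE:
  assumes "X \<in> carrier (generalized_words \<Sigma>)"
  obtains u where "u \<in> moderate_nets \<Sigma>" "X = net_class \<Sigma> u"
  using assms by (auto simp: generalized_words_def net_class_def restrict_moderate_net elim!: quotientE)

lemma net_class_in_carrier:
  "u \<in> moderate_nets \<Sigma> \<Longrightarrow> net_class \<Sigma> u \<in> carrier (generalized_words \<Sigma>)"
  by (auto simp: generalized_words_def net_class_def restrict_moderate_net intro: quotientI)

lemma generalized_words_mult:
  assumes u: "u \<in> moderate_nets \<Sigma>" and v: "v \<in> moderate_nets \<Sigma>"
  shows "net_class \<Sigma> u \<otimes>\<^bsub>generalized_words \<Sigma>\<^esub> net_class \<Sigma> v = net_class \<Sigma> (\<lambda>\<epsilon>. u \<epsilon> @ v \<epsilon>)"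
proof -
  have "congruent2 (net_equiv \<Sigma>) (net_equiv \<Sigma>) (\<lambda>u v. net_class \<Sigma> (\<lambda>\<epsilon>. u \<epsilon> @ v \<epsilon>))"
    by (rule congruent2I')
       (simp add: net_class_def equiv_class_eq[OF equiv_net_equiv net_equiv_append])
  from UN_equiv_class2[OF equiv_net_equiv equiv_net_equiv this u v] show ?thesis
    by (simp add: generalized_words_def net_class_def restrict_moderate_net[OF u]
        restrict_moderate_net[OF v])
qed

lemma net_class_cong: "(\<And>\<epsilon>. \<epsilon> \<in> {0<..1} \<Longrightarrow> u \<epsilon> = v \<epsilon>) \<Longrightarrow> net_class \<Sigma> u = net_class \<Sigma> v"
  by (simp add: net_class_def cong: restrict_cong)

lemma net_class_restrict: "net_class \<Sigma> (restrict u {0<..1}) = net_class \<Sigma> u"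
  by (rule net_class_cong) simp

lemma generalized_words_mult_restrict:
  assumes "u \<in> moderate_nets \<Sigma>" "v \<in> moderate_nets \<Sigma>"
  shows "net_class \<Sigma> u \<otimes>\<^bsub>generalized_words \<Sigma>\<^esub> net_class \<Sigma> v =
    net_class \<Sigma> (\<lambda>\<epsilon>\<in>{0<..1}. u \<epsilon> @ v \<epsilon>)"
  using generalized_words_mult[OF assms] by (simp only: net_class_restrict)

lemma generalized_words_one: "\<one>\<^bsub>generalized_words \<Sigma>\<^esub> = net_class \<Sigma> (\<lambda>\<epsilon>\<in>{0<..1}. [])"
  unfolding net_class_restrict by (simp add: generalized_words_def)

lemma monoid_generalized_words: "monoid (generalized_words \<Sigma>)"
proof (rule monoidI)
  show "\<one>\<^bsub>generalized_words \<Sigma>\<^esub> \<in> carrier (generalized_words \<Sigma>)"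
    by (simp only: generalized_words_one net_class_in_carrier moderate_nets_Nil)
next
  fix x y assume "x \<in> carrier (generalized_words \<Sigma>)" "y \<in> carrier (generalized_words \<Sigma>)"
  then show "x \<otimes>\<^bsub>generalized_words \<Sigma>\<^esub> y \<in> carrier (generalized_words \<Sigma>)"
    by (elim generalized_words_carrierE)
       (simp only: generalized_words_mult_restrict net_class_in_carrier moderate_nets_append)
next
  fix x y z assume "x \<in> carrier (generalized_words \<Sigma>)" "y \<in> carrier (generalized_words \<Sigma>)"
    "z \<in> carrier (generalized_words \<Sigma>)"
  then show "x \<otimes>\<^bsub>generalized_words \<Sigma>\<^esub> y \<otimes>\<^bsub>generalized_words \<Sigma>\<^esub> z =
      x \<otimes>\<^bsub>generalized_words \<Sigma>\<^esub> (y \<otimes>\<^bsub>generalized_words \<Sigma>\<^esub> z)"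
    by (elim generalized_words_carrierE)
       (simp only: generalized_words_mult_restrict moderate_nets_append, rule net_class_cong, simp)
next
  fix x assume "x \<in> carrier (generalized_words \<Sigma>)"
  then obtain u where u: "u \<in> moderate_nets \<Sigma>" "x = net_class \<Sigma> u"
    by (rule generalized_words_carrierE)
  show "\<one>\<^bsub>generalized_words \<Sigma>\<^esub> \<otimes>\<^bsub>generalized_words \<Sigma>\<^esub> x = x"
    unfolding generalized_words_one u(2) generalized_words_mult[OF moderate_nets_Nil u(1)]
    by (rule net_class_cong) simp
  show "x \<otimes>\<^bsub>generalized_words \<Sigma>\<^esub> \<one>\<^bsub>generalized_words \<Sigma>\<^esub> = x"
    unfolding generalized_words_one u(2) generalized_words_mult[OF u(1) moderate_nets_Nil]
    by (rule net_class_cong) simp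
qed

end

theory Submission
  imports Defs "HOL-Real_Asymp.Real_Asymp"
begin

text \<open>Two distinct powers \<open>a\<^sup>k\<close> and \<open>a\<^sup>l\<close> agree, from the left as well as from the right, on all
  of the shorter one, so their agreement is \<open>min k l\<close>.  Hence the equivalence of two nets of
  powers of \<open>a\<close> only asks that, wherever the exponents differ, both of them outgrow every multiple
  of \<open>log\<^sub>2 (1 / \<epsilon>)\<close> (lemma \<open>net_equiv_power_iff\<close>).  The exponents \<open>\<lfloor>1 / \<epsilon>\<rfloor>\<close> of \<open>U\<close> and
  \<open>\<lfloor>1 / \<epsilon>\<rfloor> + \<lfloor>log\<^sub>2 (1 / \<epsilon>)\<rfloor>\<close> of \<open>U P\<close> both do so: the factor \<open>P\<close> changes \<open>U\<close> only in the middle,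
  where the equivalence does not look, and is absorbed.  But \<open>P\<close> on its own has agreement 0 with
  the empty word as soon as it is nonempty, which is the case for all \<open>\<epsilon> \<le> 1 / 2\<close>.\<close>

lemma longest_common_prefix_replicate:
  "longest_common_prefix (replicate k a) (replicate l a) = replicate (min k l) a"
proof (induction k arbitrary: l)
  case (Suc k)
  then show ?case by (cases l) simp_all
qed simp

lemma agreement_replicate:
  "agreement (replicate k a) (replicate l a) = (if k = l then \<infinity> else enat (min k l))"
  by (auto simp: agreement_def lcp_def lcs_def longest_common_prefix_replicate)

lemma power_net_moderate:
  assumes "a \<in> \<Sigma>" and "\<And>\<epsilon>. \<epsilon> \<in> {0<..1} \<Longrightarrow> real (k \<epsilon>) \<le> 1 / \<epsilon>"
  shows "(\<lambda>\<epsilon>\<in>{0<..1}. replicate (k \<epsilon>) a) \<in> moderate_nets \<Sigma>"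
proof -
  have "moderate (\<lambda>\<epsilon>\<in>{0<..1}. replicate (k \<epsilon>) a)"
    unfolding moderate_def
    by (intro exI[of _ 1]) (use assms(2) in \<open>auto simp: power_int_minus divide_inverse\<close>)
  then show ?thesis
    using assms(1) by (auto simp: moderate_nets_def nets_def)
qed

lemma net_equiv_power_iff:
  assumes "(\<lambda>\<epsilon>\<in>{0<..1}. replicate (k \<epsilon>) a) \<in> moderate_nets \<Sigma>"
    and "(\<lambda>\<epsilon>\<in>{0<..1}. replicate (l \<epsilon>) a) \<in> moderate_nets \<Sigma>"
  shows "(\<lambda>\<epsilon>\<in>{0<..1}. replicate (k \<epsilon>) a, \<lambda>\<epsilon>\<in>{0<..1}. replicate (l \<epsilon>) a) \<in> net_equiv \<Sigma> \<longleftrightarrow>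
    (\<forall>m::nat. \<exists>\<epsilon>\<^sub>0>0. \<forall>\<epsilon>\<in>{0<..1}. \<epsilon> < \<epsilon>\<^sub>0 \<longrightarrow>
       k \<epsilon> = l \<epsilon> \<or> real m * log 2 (1 / \<epsilon>) \<le> real (min (k \<epsilon>) (l \<epsilon>)))"
proof -
  have "ereal x \<le> ereal_of_enat (agreement (replicate i a) (replicate j a)) \<longleftrightarrow>
      i = j \<or> x \<le> real (min i j)" for x i j
    by (simp add: agreement_replicate)
  with assms show ?thesis
    unfolding net_equiv_iff by (simp add: Ball_def)
qed

lemma net_class_eq_iff:
  assumes "restrict u {0<..1} \<in> moderate_nets \<Sigma>" "restrict v {0<..1} \<in> moderate_nets \<Sigma>"
  shows "net_class \<Sigma> u = net_class \<Sigma> v \<longleftrightarrow>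
    (restrict u {0<..1}, restrict v {0<..1}) \<in> net_equiv \<Sigma>"
  unfolding net_class_def by (rule eq_equiv_class_iff[OF equiv_net_equiv assms])

text \<open>The number \<open>n\<close> on the left satisfies \<open>n < 2\<^sup>n\<close> and \<open>2\<^sup>n \<le> x\<close>.\<close>

lemma floor_log2_le:
  assumes "x \<ge> 1"
  shows "real (nat \<lfloor>log 2 x\<rfloor>) \<le> x"
proof -
  let ?n = "nat \<lfloor>log 2 x\<rfloor>"
  have "real ?n \<le> log 2 x"
    using assms by (simp add: of_nat_nat)
  then have "2 ^ ?n \<le> x"
    using assms le_log_iff[of 2 x "real ?n"] powr_realpow[of 2 ?n] by simp
  moreover have "real ?n < 2 ^ ?n"
    by (rule of_nat_less_two_power)
  ultimately show ?thesis by linarith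
qed

lemma log2_multiple_le_floor:
  "\<exists>\<epsilon>\<^sub>0>0. \<forall>\<epsilon>\<in>{0<..1}. \<epsilon> < \<epsilon>\<^sub>0 \<longrightarrow> real m * log 2 (1 / \<epsilon>) \<le> real (nat \<lfloor>1 / \<epsilon>\<rfloor>)"
proof -
  \<comment> \<open>Subtracting 1 makes up for the rounding.\<close>
  have "eventually (\<lambda>\<epsilon>::real. real m * log 2 (1 / \<epsilon>) \<le> 1 / \<epsilon> - 1) (at_right 0)"
    by real_asymp
  then obtain e :: real where "e > 0"
    and e: "\<And>\<epsilon>. 0 < \<epsilon> \<Longrightarrow> \<epsilon> < e \<Longrightarrow> real m * log 2 (1 / \<epsilon>) \<le> 1 / \<epsilon> - 1"
    unfolding eventually_at_right_field by blast
  have "real m * log 2 (1 / \<epsilon>) \<le> real (nat \<lfloor>1 / \<epsilon>\<rfloor>)" if "0 < \<epsilon>" "\<epsilon> < e" for \<epsilon>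
    using e[OF that] by linarith
  with \<open>e > 0\<close> show ?thesis by auto
qed

lemma left_cancellative_one:
  assumes "monoid M" "left_cancellative M" "x \<in> carrier M" "y \<in> carrier M" "x \<otimes>\<^bsub>M\<^esub> y = x"
  shows "y = \<one>\<^bsub>M\<^esub>"
  using assms(2)[unfolded left_cancellative_def, rule_format, OF assms(3,4), of "\<one>\<^bsub>M\<^esub>"]
  by (simp add: assms(1,3,5) monoid.r_one monoid.one_closed)

theorem mainTheorem10:
  fixes \<Sigma> :: "'a set" and a :: 'a
  assumes "finite \<Sigma>" and "a \<in> \<Sigma>"
  shows "let M = generalized_words \<Sigma>;
             U = net_class \<Sigma> (\<lambda>\<epsilon>. replicate (nat \<lfloor>1 / \<epsilon>\<rfloor>) a);
             P = net_class \<Sigma> (\<lambda>\<epsilon>. replicate (nat \<lfloor>log 2 (1 / \<epsilon>)\<rfloor>) a)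
         in U \<in> carrier M \<and> P \<in> carrier M \<and>
            U \<otimes>\<^bsub>M\<^esub> P = U \<and> U = U \<otimes>\<^bsub>M\<^esub> \<one>\<^bsub>M\<^esub> \<and> P \<noteq> \<one>\<^bsub>M\<^esub> \<and>
            \<not> left_cancellative M"
proof -
  define M where "M = generalized_words \<Sigma>"
  define k l :: "real \<Rightarrow> nat" where "k \<epsilon> = nat \<lfloor>1 / \<epsilon>\<rfloor>" and "l \<epsilon> = nat \<lfloor>log 2 (1 / \<epsilon>)\<rfloor>" for \<epsilon>
  define U where "U = net_class \<Sigma> (\<lambda>\<epsilon>. replicate (k \<epsilon>) a)"
  define P where "P = net_class \<Sigma> (\<lambda>\<epsilon>. replicate (l \<epsilon>) a)"
  let ?u = "\<lambda>\<epsilon>\<in>{0<..1}. replicate (k \<epsilon>) a" and ?p = "\<lambda>\<epsilon>\<in>{0<..1}. replicate (l \<epsilon>) a"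
  interpret monoid M
    unfolding M_def by (rule monoid_generalized_words)
  have u: "?u \<in> moderate_nets \<Sigma>"
    by (rule power_net_moderate[OF assms(2)]) (auto simp: k_def intro: of_nat_floor)
  have p: "?p \<in> moderate_nets \<Sigma>"
    by (rule power_net_moderate[OF assms(2)]) (unfold l_def, rule floor_log2_le, simp)
  have U: "U \<in> carrier M" and P: "P \<in> carrier M"
    using net_class_in_carrier[OF u] net_class_in_carrier[OF p]
    by (simp_all only: U_def P_def M_def net_class_restrict)

  have up_eq: "(\<lambda>\<epsilon>\<in>{0<..1}. ?u \<epsilon> @ ?p \<epsilon>) = (\<lambda>\<epsilon>\<in>{0<..1}. replicate (k \<epsilon> + l \<epsilon>) a)"
    by (auto simp: replicate_add)
  then have up: "(\<lambda>\<epsilon>\<in>{0<..1}. replicate (k \<epsilon> + l \<epsilon>) a) \<in> moderate_nets \<Sigma>"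
    using moderate_nets_append[OF u p] by simp
  have "U \<otimes>\<^bsub>M\<^esub> P = net_class \<Sigma> (\<lambda>\<epsilon>. replicate (k \<epsilon> + l \<epsilon>) a)"
    using generalized_words_mult_restrict[OF u p]
    unfolding up_eq U_def P_def M_def net_class_restrict .
  also have "\<dots> = U"
    unfolding U_def net_class_eq_iff[OF up u] net_equiv_power_iff[OF up u]
    proof
    fix m :: nat
    obtain e :: real where "e > 0"
      and e: "\<forall>\<epsilon>\<in>{0<..1}. \<epsilon> < e \<longrightarrow> real m * log 2 (1 / \<epsilon>) \<le> real (k \<epsilon>)"
      using log2_multiple_le_floor unfolding k_def by blast
    then show "\<exists>\<epsilon>\<^sub>0>0. \<forall>\<epsilon>\<in>{0<..1}. \<epsilon> < \<epsilon>\<^sub>0 \<longrightarrow>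
        k \<epsilon> + l \<epsilon> = k \<epsilon> \<or> real m * log 2 (1 / \<epsilon>) \<le> real (min (k \<epsilon> + l \<epsilon>) (k \<epsilon>))"
      by (intro exI[of _ e]) simp
  qed
  finally have UP: "U \<otimes>\<^bsub>M\<^esub> P = U" .

  have P_ne: "P \<noteq> \<one>\<^bsub>M\<^esub>"
  proof
    \<comment> \<open>The empty word is written as a power, so that \<open>net_equiv_power_iff\<close> applies.\<close>
    have nil: "(\<lambda>\<epsilon>\<in>{0<..1}. replicate 0 a) \<in> moderate_nets \<Sigma>"
      using moderate_nets_Nil by simp
    assume "P = \<one>\<^bsub>M\<^esub>"
    then have "net_class \<Sigma> (\<lambda>\<epsilon>. replicate (l \<epsilon>) a) = net_class \<Sigma> (\<lambda>\<epsilon>. replicate 0 a)"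
      by (simp add: P_def M_def generalized_words_def)
    then have "\<forall>m::nat. \<exists>\<epsilon>\<^sub>0>0. \<forall>\<epsilon>\<in>{0<..1}. \<epsilon> < \<epsilon>\<^sub>0 \<longrightarrow>
        l \<epsilon> = 0 \<or> real m * log 2 (1 / \<epsilon>) \<le> real (min (l \<epsilon>) 0)"
      unfolding net_class_eq_iff[OF p nil] net_equiv_power_iff[OF p nil] .
    then obtain e :: real where "e > 0"
      and e: "\<And>\<epsilon>. \<epsilon> \<in> {0<..1} \<Longrightarrow> \<epsilon> < e \<Longrightarrow> l \<epsilon> = 0 \<or> log 2 (1 / \<epsilon>) \<le> 0"
      by (force dest: spec[of _ 1])
    define \<epsilon> where "\<epsilon> = min (1 / 2) (e / 2)"
    have \<epsilon>: "0 < \<epsilon>" "\<epsilon> \<le> 1 / 2" "\<epsilon> < e"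
      using \<open>e > 0\<close> by (auto simp: \<epsilon>_def)
    have "1 \<le> log 2 (1 / \<epsilon>)"
      using \<epsilon> by (simp add: le_log_iff field_simps)
    moreover from this have "l \<epsilon> \<noteq> 0"
      unfolding l_def by linarith
    ultimately show False
      using e[of \<epsilon>] \<epsilon> by simp
  qed
  moreover have "\<not> left_cancellative M"
    using left_cancellative_one[OF monoid_axioms _ U P UP] P_ne by blast
  ultimately show ?thesis
    using U P UP by (simp add: Let_def M_def[symmetric] k_def[symmetric] l_def[symmetric]
        U_def[symmetric] P_def[symmetric])
qed

end
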